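(* For every $n\geq 0$ and every $P\in\mathcal{D}_n^{h,\geq}$, $$\#DDD(P)=2\big(\#UU(\phi(P))+\#UF(\phi(P))\big)-\#FD(\phi(P))-\#FUU(\phi(P))-\#FUF(\phi(P)).$$
   Context: A Motzkin path of length $n$ is a word in the steps $U=(1,1)$, $D=(1,-1)$, $F=(1,0)$ forming a lattice path from $(0,0)$ to $(n,0)$ never going below the $x$-axis; $\mathcal{M}_n$ is the set of them. A Dyck path of semilength $n$ is a Motzkin path of length $2n$ without $F$ steps. Every nonempty Dyck path has a unique first return decomposition $P=U\alpha D\beta$ with $\alpha,\beta$ Dyck paths; $h$ denotes maximal height. $\mathcal{D}^{h,\geq}$ is defined recursively: it contains the empty path $\epsilon$, and $P=U\alpha D\beta$ belongs to it iff $\alpha,\beta\in\mathcal{D}^{h,\geq}$ and $h(U\alpha D)\geq h(\beta)$; $\mathcal{D}_n^{h,\geq}$ is the subset of semilength $n$. The bijection $\phi:\mathcal{D}_n^{h,\geq}\to\mathcal{M}_n$ is defined by $\phi(\epsilon)=\epsilon$, $\phi(\alpha UD)=\phi(\alpha)F$, $\phi(\alpha UU\beta D\gamma D)=\phi(\alpha)\phi(\gamma)U\phi(\beta)D$. For a word $X$, $\#X(P)$ is the number of occurrences of $X$ as consecutive steps in $P$. *)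

theory Defs
  imports Main
begin

datatype step = U | D | F

fun dy :: "step \<Rightarrow> int" where
  "dy U = 1"
| "dy D = -1"
| "dy F = 0"

text \<open>Ordinate of the endpoint of a word read as a lattice path starting at the origin.\<close>

definition ht :: "step list \<Rightarrow> int" where
  "ht w = sum_list (map dy w)"

definition max_height :: "step list \<Rightarrow> int" where
  "max_height w = Max {ht (take k w) | k. k \<le> length w}"

definition motzkin_paths :: "nat \<Rightarrow> step list set" where
  "motzkin_paths n =
     {w. length w = n \<and> ht w = 0 \<and> (\<forall>k\<le>length w. 0 \<le> ht (take k w))}"

text \<open>Dyck paths are indexed by their semilength.\<close>

definition dyck_paths :: "nat \<Rightarrow> step list set" where
  "dyck_paths n = {w \<in> motzkin_paths (2 * n). F \<notin> set w}"

definition dyck :: "step list \<Rightarrow> bool" where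
  "dyck w \<longleftrightarrow> (\<exists>n. w \<in> dyck_paths n)"

text \<open>By uniqueness of the first return decomposition (\<open>first_return_unique\<close> below), the rule is
  an equivalence: a nonempty Dyck path belongs to the set iff its decomposition satisfies the
  premises.\<close>

inductive_set dyck_h_geq :: "step list set" where
  empty: "[] \<in> dyck_h_geq"
| first_return:
    "\<lbrakk>\<alpha> \<in> dyck_h_geq; \<beta> \<in> dyck_h_geq; max_height ([U] @ \<alpha> @ [D]) \<ge> max_height \<beta>\<rbrakk>
      \<Longrightarrow> [U] @ \<alpha> @ [D] @ \<beta> \<in> dyck_h_geq"

definition dyck_h_geq_n :: "nat \<Rightarrow> step list set" where
  "dyck_h_geq_n n = dyck_h_geq \<inter> dyck_paths n"

text \<open>Occurrences may overlap.\<close>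

definition occ :: "step list \<Rightarrow> step list \<Rightarrow> nat" where
  "occ X P = card {i. i + length X \<le> length P \<and> take (length X) (drop i P) = X}"


lemma ht_simps [simp]:
  "ht [] = 0" "ht (x # w) = dy x + ht w" "ht (v @ w) = ht v + ht w"
  by (simp_all add: ht_def)

lemma even_ht: "F \<notin> set w \<Longrightarrow> even (ht w) \<longleftrightarrow> even (length w)"
proof (induction w)
  case (Cons a w)
  then show ?case by (cases a) auto
qed simp

lemma dyck_iff:
  "dyck w \<longleftrightarrow> F \<notin> set w \<and> ht w = 0 \<and> (\<forall>k\<le>length w. 0 \<le> ht (take k w))"
  using even_ht[of w] by (auto simp: dyck_def dyck_paths_def motzkin_paths_def elim!: evenE)

lemma dyck_prefix: "dyck (v @ w) \<Longrightarrow> 0 \<le> ht v"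
proof -
  assume "dyck (v @ w)"
  then have "0 \<le> ht (take (length v) (v @ w))"
    unfolding dyck_iff by (metis length_append le_add1)
  then show ?thesis by simp
qed

lemma dyckI:
  assumes "F \<notin> set w" "ht w = 0" "\<And>u v. w = u @ v \<Longrightarrow> 0 \<le> ht u"
  shows "dyck w"
  using assms(1,2) assms(3)[OF append_take_drop_id[symmetric]] by (simp add: dyck_iff)

lemma dyck_Nil [simp]: "dyck []"
  by (simp add: dyck_iff)

lemma dyck_append: "dyck v \<Longrightarrow> dyck w \<Longrightarrow> dyck (v @ w)"
proof (rule dyckI)
  fix a b assume d: "dyck v" "dyck w" and "v @ w = a @ b"
  then consider c where "v = a @ c" | c where "a = v @ c" "w = c @ b"
    by (auto simp: append_eq_append_conv2)
  then show "0 \<le> ht a"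
  proof cases
    case 1 then show ?thesis using d dyck_prefix by blast
  next
    case 2
    then have "0 \<le> ht c" using d dyck_prefix by blast
    then show ?thesis using 2 d by (simp add: dyck_iff)
  qed
qed (auto simp: dyck_iff)

lemma dyck_lift: "dyck w \<Longrightarrow> dyck (U # w @ [D])"
proof (rule dyckI)
  fix a b assume d: "dyck w" and e: "U # w @ [D] = a @ b"
  show "0 \<le> ht a"
  proof (cases a)
    case (Cons x a')
    then have x: "x = U" and "w @ [D] = a' @ b" using e by auto
    then consider c where "w = a' @ c" | "a' = w @ [D]"
      by (auto simp: append_eq_append_conv2 append_eq_Cons_conv Cons_eq_append_conv)
    then have "- 1 \<le> ht a'"
      using d dyck_prefix[of a'] by cases (force simp: dyck_iff)+
    then show ?thesis using Cons x by simp
  qed simp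
qed (auto simp: dyck_iff)

lemma dyck_last: "dyck w \<Longrightarrow> w \<noteq> [] \<Longrightarrow> last w = D"
proof -
  assume d: "dyck w" and "w \<noteq> []"
  then obtain v x where w: "w = v @ [x]" by (metis append_butlast_last_id)
  then have "0 \<le> ht v" using d dyck_prefix by blast
  moreover have "ht v + dy x = 0" "x \<noteq> F" using d w by (auto simp: dyck_iff)
  ultimately show ?thesis using w by (cases x) auto
qed

lemma prime_dyck:
  assumes "w \<noteq> []" "F \<notin> set w" "ht w = 0"
    and pos: "\<And>u v. w = u @ v \<Longrightarrow> u \<noteq> [] \<Longrightarrow> v \<noteq> [] \<Longrightarrow> 0 < ht u"
  shows "\<exists>\<delta>. w = U # \<delta> @ [D] \<and> dyck \<delta>"
proof -
  obtain x v where w: "w = x # v" using assms(1) by (cases w) auto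
  have "v \<noteq> []" using assms(2,3) w by (cases x) auto
  then obtain \<delta> y where v: "v = \<delta> @ [y]" by (metis append_butlast_last_id)
  have "x = U" using pos[of "[x]" v] w \<open>v \<noteq> []\<close> by (cases x) auto
  have "0 < ht (x # \<delta>)" using pos[of "x # \<delta>" "[y]"] w v by simp
  then have "y = D" using assms(2,3) w v by (cases y) auto
  have "dyck \<delta>"
  proof (rule dyckI)
    fix a b assume "\<delta> = a @ b"
    then have "0 < ht (x # a)" using pos[of "x # a" "b @ [y]"] w v by simp
    then show "0 \<le> ht a" using \<open>x = U\<close> by simp
  qed (use assms(2,3) w v \<open>x = U\<close> \<open>y = D\<close> in auto)
  then show ?thesis using w v \<open>x = U\<close> \<open>y = D\<close> by blast
qed

lemma dyck_suffix:
  assumes "dyck (v @ w)" "ht v = 0" shows "dyck w"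
proof (rule dyckI)
  fix a b assume "w = a @ b"
  then show "0 \<le> ht a" using dyck_prefix[of "v @ a" b] assms by simp
qed (use assms in \<open>auto simp: dyck_iff\<close>)

lemma first_return_ex:
  assumes "dyck P" "P \<noteq> []"
  obtains \<alpha> \<beta> where "dyck \<alpha>" "dyck \<beta>" "P = U # \<alpha> @ D # \<beta>"
proof -
  let ?Q = "\<lambda>k. 0 < k \<and> k \<le> length P \<and> ht (take k P) = 0"
  define k where "k = (LEAST k. ?Q k)"
  have "?Q (length P)" using assms by (auto simp: dyck_iff)
  then have k: "?Q k" unfolding k_def by (rule LeastI)
  have least: "\<not> ?Q j" if "j < k" for j using not_less_Least[of j ?Q] that unfolding k_def by blast
  have "\<exists>\<delta>. take k P = U # \<delta> @ [D] \<and> dyck \<delta>"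
  proof (rule prime_dyck)
    show "take k P \<noteq> []" using k assms(2) by auto
    show "F \<notin> set (take k P)" using assms by (auto simp: dyck_iff dest: in_set_takeD)
    show "ht (take k P) = 0" using k by simp
    fix u v assume uv: "take k P = u @ v" "u \<noteq> []" "v \<noteq> []"
    have l: "length u < k" using arg_cong[OF uv(1), of length] uv(3)
      by (cases v) (auto simp: min_def split: if_splits)
    have P: "P = u @ (v @ drop k P)" by (simp flip: append_assoc uv(1))
    have "take (length u) P = u" using arg_cong[OF P, of "take (length u)"] by simp
    then have "ht u \<noteq> 0" using least[OF l] l k uv(2) by auto
    moreover have "0 \<le> ht u" using dyck_prefix[of u "v @ drop k P"] assms(1) P[symmetric] by simp
    ultimately show "0 < ht u" by simp
  qed
  moreover have "dyck (drop k P)"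
    using dyck_suffix[of "take k P" "drop k P"] assms(1) k by simp
  ultimately show ?thesis
    using that by (metis append.assoc append_Cons append_Nil append_take_drop_id)
qed

lemma last_return_ex:
  assumes "dyck P" "P \<noteq> []"
  obtains \<alpha> \<delta> where "dyck \<alpha>" "dyck \<delta>" "P = \<alpha> @ U # \<delta> @ [D]"
  using assms
proof (induction "length P" arbitrary: P thesis rule: less_induct)
  case less
  obtain \<alpha> \<beta> where ab: "dyck \<alpha>" "dyck \<beta>" "P = U # \<alpha> @ D # \<beta>"
    using first_return_ex less.prems by metis
  show ?case
  proof (cases "\<beta> = []")
    case True
    then show ?thesis using less.prems(1)[of "[]" \<alpha>] ab by simp
  next
    case False
    then obtain \<gamma> \<delta> where "dyck \<gamma>" "dyck \<delta>" "\<beta> = \<gamma> @ U # \<delta> @ [D]"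
      using less.hyps[of \<beta>] ab by auto
    then show ?thesis
      using less.prems(1)[of "(U # \<alpha> @ [D]) @ \<gamma>" \<delta>] ab dyck_append[OF dyck_lift] by simp
  qed
qed

lemma first_return_unique:
  assumes "\<alpha> @ D # \<beta> = \<alpha>' @ D # \<beta>'" "dyck \<alpha>" "dyck \<alpha>'"
  shows "\<alpha> = \<alpha>' \<and> \<beta> = \<beta>'"
proof -
  have no: False if "dyck (v @ D # w)" "dyck v" for v w
    using dyck_prefix[of "v @ [D]" w] that by (simp add: dyck_iff)
  show ?thesis
    using assms no by (auto simp: append_eq_append_conv2 append_eq_Cons_conv Cons_eq_append_conv)
qed

lemma last_return_unique:
  assumes "\<alpha> @ U # \<delta> = \<alpha>' @ U # \<delta>'" "dyck \<alpha>" "dyck \<delta>" "dyck \<alpha>'" "dyck \<delta>'"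
  shows "\<alpha> = \<alpha>' \<and> \<delta> = \<delta>'"
proof -
  have no: False if "dyck (v @ U # w)" "dyck v" "dyck (w @ u)" for u v w
    using dyck_prefix[of w u] that by (simp add: dyck_iff)
  from assms(1) consider "\<alpha> = \<alpha>'" | w u where "\<alpha>' = \<alpha> @ U # w" "\<delta> = w @ u"
    | w u where "\<alpha> = \<alpha>' @ U # w" "\<delta>' = w @ u"
    by (auto simp: append_eq_append_conv2 append_eq_Cons_conv Cons_eq_append_conv)
  then show ?thesis
  proof cases
    case 1 then show ?thesis using assms(1) by simp
  next
    case 2 then show ?thesis using no[of \<alpha>] assms by blast
  next
    case 3 then show ?thesis using no[of \<alpha>'] assms by blast
  qed
qed

lemma dyck_UD: "dyck \<alpha> \<Longrightarrow> dyck (\<alpha> @ [U, D])"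
  using dyck_append[of \<alpha> "[U, D]"] dyck_lift[of "[]"] by simp

lemma dyck_UUDD:
  "dyck \<alpha> \<Longrightarrow> dyck \<beta> \<Longrightarrow> dyck \<gamma> \<Longrightarrow> dyck (\<alpha> @ [U, U] @ \<beta> @ [D] @ \<gamma> @ [D])"
  using dyck_append[OF _ dyck_lift[OF dyck_append[OF dyck_lift, of \<beta> \<gamma>]], of \<alpha>] by simp

text \<open>The clauses make sense for, and are used on, all Dyck paths; the map of interest is the
  restriction to \<^term>\<open>dyck_h_geq\<close>. The value on words that are not Dyck paths is a dummy.\<close>

function phi :: "step list \<Rightarrow> step list" where
  "phi [] = []"
| "dyck \<alpha> \<Longrightarrow> phi (\<alpha> @ [U, D]) = phi \<alpha> @ [F]"
| "\<lbrakk>dyck \<alpha>; dyck \<beta>; dyck \<gamma>\<rbrakk> \<Longrightarrow>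
     phi (\<alpha> @ [U, U] @ \<beta> @ [D] @ \<gamma> @ [D]) = phi \<alpha> @ phi \<gamma> @ [U] @ phi \<beta> @ [D]"
| "\<not> dyck P \<Longrightarrow> phi P = []"
proof goal_cases
  case (1 Q P)
  show ?case
  proof (cases "dyck P \<and> P \<noteq> []")
    case True
    then obtain \<alpha> \<delta> where a: "dyck \<alpha>" "dyck \<delta>" "P = \<alpha> @ U # \<delta> @ [D]"
      using last_return_ex by metis
    show ?thesis
    proof (cases "\<delta> = []")
      case True
      then show ?thesis using 1(2) a by simp
    next
      case False
      then obtain \<beta> \<gamma> where "dyck \<beta>" "dyck \<gamma>" "\<delta> = U # \<beta> @ D # \<gamma>"
        using first_return_ex a by metis
      then show ?thesis using 1(3)[of \<alpha> \<beta> \<gamma>] a by simp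
    qed
  next
    case False
    then show ?thesis using 1(1,4) by auto
  qed
next
  case (7 \<alpha> \<alpha>' \<beta> \<gamma>)
  then have "\<alpha> @ [U] = \<alpha>' @ [U, U] @ \<beta> @ [D] @ \<gamma>" by simp
  then have "last (\<alpha> @ [U]) = last (\<alpha>' @ [U, U] @ \<beta> @ [D] @ \<gamma>)" by (rule arg_cong)
  then have "U = last (D # \<gamma>)" by simp
  then show ?case using dyck_last[of \<gamma>] 7 by (auto split: if_splits)
next
  case (9 \<alpha> \<beta> \<gamma> \<alpha>' \<beta>' \<gamma>')
  have d: "dyck (U # \<beta> @ D # \<gamma>)" "dyck (U # \<beta>' @ D # \<gamma>')"
    using dyck_append[OF dyck_lift] 9 by force+
  have "\<alpha> @ U # (U # \<beta> @ D # \<gamma>) = \<alpha>' @ U # (U # \<beta>' @ D # \<gamma>')" using 9 by simp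
  then have "\<alpha> = \<alpha>' \<and> U # \<beta> @ D # \<gamma> = U # \<beta>' @ D # \<gamma>'"
    by (rule last_return_unique) (use d 9 in auto)
  then show ?case using first_return_unique[of \<beta> \<gamma> \<beta>' \<gamma>'] 9 by simp
next
  case (8 \<alpha> P) then show ?case using dyck_UD[of \<alpha>] by auto
next
  case (10 \<alpha> \<beta> \<gamma> P) then show ?case using dyck_UUDD[of \<alpha> \<beta> \<gamma>] by auto
qed simp_all
termination by (relation "measure length") simp_all

end

theory Submission
  imports Defs
begin

text \<open>Write \<open>P = \<alpha>UU\<beta>D\<gamma>D\<close>, so that \<open>\<phi>(P) = \<phi>(\<alpha>)\<phi>(\<gamma>)U\<phi>(\<beta>)D\<close>. Both statistics are additive over
  \<open>\<alpha>, \<beta>, \<gamma>\<close> up to a correction that depends only on whether \<open>\<beta>\<close> and \<open>\<gamma>\<close> are empty or end with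
  \<open>UD\<close>; a nonempty Dyck path ends with \<open>UD\<close> or \<open>DD\<close>, according to whether its image ends with \<open>F\<close>
  or \<open>D\<close>. The height condition is used twice: it prevents \<open>\<alpha>\<close> from ending with \<open>UD\<close>, so nothing
  is created where \<open>\<phi>(\<alpha>)\<close> meets \<open>\<phi>(\<gamma>)\<close>, and for \<open>\<beta> = \<epsilon>\<close> it forces \<open>\<gamma>\<close> to be a power of \<open>UD\<close>,
  which makes the two corrections agree in the one case where they could differ.\<close>

section \<open>Counting occurrences of a pattern\<close>

lemma occ_Nil [simp]: "X \<noteq> [] \<Longrightarrow> occ X [] = 0"
  by (simp add: occ_def)

lemma occ_Cons:
  assumes "X \<noteq> []"
  shows "occ X (x # w) = (if take (length X) (x # w) = X then 1 else 0) + occ X w"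
proof -
  let ?A = "\<lambda>P. {i. i + length X \<le> length P \<and> take (length X) (drop i P) = X}"
  let ?B = "if take (length X) (x # w) = X then {0::nat} else {}"
  have fin: "finite (?A w)"
    by (rule finite_subset[of _ "{..length w}"]) auto
  have len: "length X \<le> length P" if "take (length X) P = X" for P :: "step list"
    using arg_cong[OF that, of length] by simp
  have "i \<in> ?A (x # w) \<longleftrightarrow> i \<in> ?B \<union> Suc ` ?A w" for i
    using len[of "x # w"] by (cases i) auto
  then have "?A (x # w) = ?B \<union> Suc ` ?A w"
    by blast
  moreover have "card (?B \<union> Suc ` ?A w) = card ?B + card (?A w)"
    using fin by (subst card_Un_disjoint) (auto simp: card_image)
  ultimately show ?thesis
    by (simp add: occ_def)
qed

text \<open>A window \<open>DDD\<close> contains no \<open>U\<close>, so no occurrence reaches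
  across the cut.\<close>

lemma occ_DDD_append_U: "occ [D, D, D] (v @ U # w) = occ [D, D, D] v + occ [D, D, D] w"
proof (induction v)
  case (Cons x v)
  have "take 3 (x # v @ U # w) = [D, D, D] \<longleftrightarrow> take 3 (x # v) = [D, D, D]"
    by (cases v; cases "tl v") (auto simp: eval_nat_numeral)
  then show ?case
    using Cons by (simp add: occ_Cons eval_nat_numeral)
qed (simp add: occ_Cons)

lemma occ_DDD_append_DDD:
  "occ [D, D, D] (v @ [D, D, D]) = Suc (occ [D, D, D] (v @ [D, D]))"
proof (induction v)
  case (Cons x v)
  have "take 3 (x # v @ [D, D, D]) = [D, D, D] \<longleftrightarrow> take 3 (x # v @ [D, D]) = [D, D, D]"
    by (cases v; cases "tl v") (auto simp: eval_nat_numeral)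
  then show ?case
    using Cons by (simp add: occ_Cons eval_nat_numeral)
qed (simp add: occ_Cons)

section \<open>The right-hand side as a sum of local weights\<close>

definition motzkin_stat :: "step list \<Rightarrow> int" where
  "motzkin_stat w = 2 * (int (occ [U, U] w) + int (occ [U, F] w))
     - int (occ [F, D] w) - int (occ [F, U, U] w) - int (occ [F, U, F] w)"

lemma motzkin_stat_Nil: "motzkin_stat [] = 0"
  by (simp add: motzkin_stat_def)

text \<open>None of the five patterns is a prefix of another, so at most one starts at the first
  letter and a single coefficient is charged there. Summed over all suffixes, these weights give
  \<open>motzkin_stat\<close>.\<close>

fun motzkin_weight :: "step list \<Rightarrow> int" where
  "motzkin_weight (U # U # w) = 2"
| "motzkin_weight (U # F # w) = 2"
| "motzkin_weight (F # D # w) = - 1"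
| "motzkin_weight (F # U # U # w) = - 1"
| "motzkin_weight (F # U # F # w) = - 1"
| "motzkin_weight w = 0"

lemma motzkin_stat_Cons: "motzkin_stat (x # w) = motzkin_weight (x # w) + motzkin_stat w"
  by (cases "x # w" rule: motzkin_weight.cases) (auto simp: motzkin_stat_def occ_Cons)

lemmas motzkin_stat_simps = motzkin_stat_Nil motzkin_stat_Cons

text \<open>No pattern in the statistic has \<open>D\<close> or \<open>F\<close> strictly inside, so the path may be cut there.\<close>

lemma motzkin_stat_append:
  assumes "x \<noteq> U"
  shows "motzkin_stat (v @ x # w) = motzkin_stat (v @ [x]) + motzkin_stat (x # w)"
proof (induction v)
  case Nil
  then show ?case
    using assms by (cases x) (auto simp: motzkin_stat_simps)
next
  case (Cons y v)
  have "motzkin_weight (y # v @ x # w) = motzkin_weight (y # v @ [x])"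
    using assms by (cases "y # v @ x # w" rule: motzkin_weight.cases)
      (auto simp: Cons_eq_append_conv append_eq_Cons_conv)
  then show ?case
    using Cons motzkin_stat_Cons[of y] by simp
qed

section \<open>Heights and the recursive height condition\<close>

lemma finite_heights: "finite {ht (take k w) | k. k \<le> length w}"
  by (rule finite_subset[of _ "(\<lambda>k. ht (take k w)) ` {..length w}"]) auto

lemma ht_le_max_height: "ht u \<le> max_height (u @ v)"
  unfolding max_height_def
  by (rule Max_ge[OF finite_heights]) (auto intro!: exI[of _ "length u"])

lemma max_height_append_ge: "max_height u \<le> max_height (u @ v)"
proof -
  have "ht (take k u) \<le> max_height (u @ v)" for k
    using ht_le_max_height[of "take k u" "drop k u @ v"]
    by (metis append.assoc append_take_drop_id)
  moreover have "{ht (take k u) | k. k \<le> length u} \<noteq> {}"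
    by blast
  ultimately show ?thesis
    unfolding max_height_def[of u] by (subst Max_le_iff[OF finite_heights]) auto
qed

lemma max_height_UD: "max_height [U, D] = 1"
proof -
  have "{ht (take k [U, D]) | k. k \<le> length [U, D]} = {0, 1}"
    by (auto simp: le_Suc_eq numeral_2_eq_2 intro: exI[of _ 0] exI[of _ 1])
  then show ?thesis
    by (simp add: max_height_def)
qed

lemma dyck_h_geq_dyck: "P \<in> dyck_h_geq \<Longrightarrow> dyck P"
proof (induction rule: dyck_h_geq.induct)
  case (first_return \<alpha> \<beta>)
  then show ?case
    using dyck_append[OF dyck_lift, of \<alpha> \<beta>] by simp
qed simp

lemma dyck_h_geq_first_returnD:
  assumes "U # \<alpha> @ D # \<beta> \<in> dyck_h_geq" "dyck \<alpha>"
  shows "\<alpha> \<in> dyck_h_geq" "\<beta> \<in> dyck_h_geq" "max_height \<beta> \<le> max_height (U # \<alpha> @ [D])"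
proof -
  obtain \<alpha>' \<beta>' where *: "\<alpha> @ D # \<beta> = \<alpha>' @ D # \<beta>'" "\<alpha>' \<in> dyck_h_geq" "\<beta>' \<in> dyck_h_geq"
    "max_height \<beta>' \<le> max_height (U # \<alpha>' @ [D])"
    using assms(1) by (cases rule: dyck_h_geq.cases) auto
  then have "\<alpha> = \<alpha>' \<and> \<beta> = \<beta>'"
    using assms(2) dyck_h_geq_dyck by (intro first_return_unique)
  then show "\<alpha> \<in> dyck_h_geq" "\<beta> \<in> dyck_h_geq" "max_height \<beta> \<le> max_height (U # \<alpha> @ [D])"
    using * by auto
qed

lemma dyck_nonempty_U: "dyck P \<Longrightarrow> P \<noteq> [] \<Longrightarrow> \<exists>w. P = U # w"
  by (metis first_return_ex)

lemma dyck_nonempty_D: "dyck P \<Longrightarrow> P \<noteq> [] \<Longrightarrow> \<exists>w. P = w @ [D]"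
  by (metis append_butlast_last_id dyck_last)

text \<open>Bridges the class, defined by first returns, and \<open>phi\<close>, which recurses at
  the last return. The induction strips the first factor \<open>U a D\<close> from \<alpha>; what
  follows it is again in the class.\<close>

lemma dyck_h_geq_last_returnD:
  assumes "\<alpha> @ U # \<delta> @ [D] \<in> dyck_h_geq" "dyck \<alpha>" "dyck \<delta>"
  shows "\<alpha> \<in> dyck_h_geq \<and> \<delta> \<in> dyck_h_geq \<and> (\<delta> \<noteq> [] \<longrightarrow> (\<forall>\<xi>. \<alpha> \<noteq> \<xi> @ [U, D]))"
  using assms
proof (induction "length \<alpha>" arbitrary: \<alpha> rule: less_induct)
  case less
  show ?case
  proof (cases "\<alpha> = []")
    case True
    then show ?thesis
      using dyck_h_geq_first_returnD[of \<delta> "[]"] less.prems by (simp add: dyck_h_geq.empty)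
  next
    case False
    then obtain a b where ab: "dyck a" "dyck b" "\<alpha> = U # a @ D # b"
      using first_return_ex less.prems(2) by metis
    then have P: "U # a @ D # (b @ U # \<delta> @ [D]) \<in> dyck_h_geq"
      using less.prems(1) by simp
    note D = dyck_h_geq_first_returnD[OF P ab(1)]
    have IH: "b \<in> dyck_h_geq" "\<delta> \<in> dyck_h_geq" "\<delta> \<noteq> [] \<Longrightarrow> \<forall>\<xi>. b \<noteq> \<xi> @ [U, D]"
      using less.hyps[of b] D(2) ab less.prems by auto
    have "max_height b \<le> max_height (U # a @ [D])"
      using max_height_append_ge D(3) by (rule order_trans)
    then have "\<alpha> \<in> dyck_h_geq"
      using dyck_h_geq.first_return[of a b] D(1) IH(1) ab(3) by simp
    moreover have False if d: "\<delta> \<noteq> []" and \<xi>: "\<alpha> = \<xi> @ [U, D]" for \<xi>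
    proof (cases "b = []")
      case True
      obtain w where "\<delta> = U # w"
        using dyck_nonempty_U less.prems(3) d by blast
      then have "2 \<le> max_height (b @ U # \<delta> @ [D])"
        using ht_le_max_height[of "[U, U]" "w @ [D]"] True by simp
      \<comment> \<open>With \<open>a\<close> empty, \<open>U a D\<close> would have height 1, less
        than what follows it.\<close>
      then have "a \<noteq> []"
        using D(3) max_height_UD by auto
      then obtain c where "a = c @ [D]"
        using dyck_nonempty_D ab(1) by blast
      then show False
        using arg_cong[OF \<xi>, of "\<lambda>w. last (butlast w)"] ab(3) True
        by (simp add: butlast_append)
    next
      case False
      then obtain c where c: "b = c @ [D]"
        using dyck_nonempty_D ab(2) by blast
      \<comment> \<open>As \<open>b\<close> ends at height 0, it has at least two letters, so the
        final \<open>UD\<close> of \<alpha> lies inside \<open>b\<close>.\<close>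
      then have "c \<noteq> []"
        using ab(2) by (auto simp: dyck_iff)
      then obtain c' y where "c = c' @ [y]"
        by (metis append_butlast_last_id)
      then have "b = c' @ [U, D]"
        using \<xi> ab(3) c by (auto simp: append_eq_Cons_conv Cons_eq_append_conv
            append_eq_append_conv2)
      then show False
        using IH(3) d by blast
    qed
    ultimately show ?thesis
      using IH(2) by blast
  qed
qed

section \<open>First and last letters under \<open>phi\<close>, and the two corrections\<close>

lemma phi_last_cases:
  assumes "dyck P"
  obtains "P = []" "phi P = []"
    | \<xi> \<eta> where "P = \<xi> @ [U, D]" "phi P = \<eta> @ [F]"
    | \<xi> \<eta> where "P = \<xi> @ [D, D]" "phi P = \<eta> @ [D]"
proof (cases P rule: phi.cases)
  case (3 \<alpha> \<beta> \<gamma>)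
  \<comment> \<open>\<gamma> is empty or ends with \<open>D\<close>, so this clause always yields a
    path ending with \<open>DD\<close>.\<close>
  have "\<exists>w. D # \<gamma> = w @ [D]"
    using dyck_nonempty_D[OF 3(3)] by (cases "\<gamma> = []") auto
  then obtain w where "D # \<gamma> = w @ [D]"
    by blast
  then have "P = (\<alpha> @ [U, U] @ \<beta> @ w) @ [D, D]"
    using 3(4) by simp
  then show ?thesis
    using that(3)[of _ "phi \<alpha> @ phi \<gamma> @ U # phi \<beta>"] phi.simps(3)[OF 3(1-3)] 3(4) by simp
qed (use assms that in auto)

text \<open>Ensures that a \<open>U\<close> placed before \<open>phi \<beta>\<close> starts
  \<open>UU\<close> or \<open>UF\<close> whenever \<beta> is nonempty.\<close>

lemma phi_hd:
  assumes "dyck P" "P \<noteq> []"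
  shows "\<exists>x w. phi P = x # w \<and> x \<noteq> D"
  using assms
proof (induction P rule: phi.induct)
  case (2 \<alpha>)
  then show ?case
    using phi.simps(2)[of "[]"] by (cases "\<alpha> = []") auto
next
  case (3 \<alpha> \<beta> \<gamma>)
  then show ?case
    unfolding phi.simps(3)[OF 3(1-3)] by (cases "\<alpha> = []"; cases "\<gamma> = []") auto
qed simp_all

text \<open>New occurrences can end only at the two displayed \<open>D\<close>s. A nonempty \<gamma>
  starts with \<open>U\<close> and separates them; if \<gamma> is empty they are adjacent, and the
  second completes \<open>DDD\<close> iff \<beta> is nonempty.\<close>

lemma occ_DDD_UUDD:
  assumes "dyck \<beta>" "dyck \<gamma>"
  shows "int (occ [D, D, D] (\<alpha> @ [U, U] @ \<beta> @ [D] @ \<gamma> @ [D])) =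
    int (occ [D, D, D] \<alpha>) + int (occ [D, D, D] \<beta>) + int (occ [D, D, D] \<gamma>)
    + (if \<exists>\<xi>. \<beta> = \<xi> @ [D, D] then 1 else 0)
    + (if \<gamma> = [] then (if \<beta> = [] then 0 else 1)
       else if \<exists>\<xi>. \<gamma> = \<xi> @ [D, D] then 1 else 0)"
proof -
  have one: "int (occ [D, D, D] (P @ [D])) =
      int (occ [D, D, D] P) + (if \<exists>\<xi>. P = \<xi> @ [D, D] then 1 else 0)" if "dyck P" for P
    using that
    by (cases rule: phi_last_cases)
      (auto simp: occ_Cons occ_DDD_append_U occ_DDD_append_DDD)
  have two: "int (occ [D, D, D] (P @ [D, D])) = int (occ [D, D, D] (P @ [D]))
      + (if P = [] then 0 else 1)" if "dyck P" for P
    using dyck_nonempty_D[OF that] by (auto simp: occ_Cons occ_DDD_append_DDD)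
  have start: "occ [D, D, D] (\<alpha> @ U # U # w) = occ [D, D, D] \<alpha> + occ [D, D, D] w" for w
    using occ_DDD_append_U[of "[]" w] by (simp add: occ_DDD_append_U)
  show ?thesis
  proof (cases "\<gamma> = []")
    case True
    then show ?thesis
      using start[of "\<beta> @ [D, D]"] two[OF assms(1)] one[OF assms(1)] by simp
  next
    case False
    then obtain w where "\<gamma> = U # w"
      using dyck_nonempty_U assms(2) by blast
    then have "occ [D, D, D] (\<beta> @ D # \<gamma> @ [D]) =
        occ [D, D, D] (\<beta> @ [D]) + occ [D, D, D] (\<gamma> @ [D])"
      using occ_DDD_append_U[of "\<beta> @ [D]" "w @ [D]"] occ_DDD_append_U[of "[]" "w @ [D]"]
      by simp
    then show ?thesis
      using False start[of "\<beta> @ D # \<gamma> @ [D]"] one assms by simp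
  qed
qed

text \<open>For nonempty \<beta>, the inserted \<open>U\<close> gains 2 from \<open>UU\<close> or
  \<open>UF\<close>, less 1 for \<open>FUU\<close> or \<open>FUF\<close> if
  \<open>phi \<gamma>\<close> ends with \<open>F\<close>. The final \<open>D\<close> costs 1 for
  \<open>FD\<close> if \<open>phi \<beta>\<close> ends with \<open>F\<close>.\<close>

lemma motzkin_stat_phi_UUDD:
  assumes "dyck \<alpha>" "dyck \<beta>" "dyck \<gamma>" "\<forall>\<xi>. \<alpha> \<noteq> \<xi> @ [U, D]"
  shows "motzkin_stat (phi \<alpha> @ phi \<gamma> @ [U] @ phi \<beta> @ [D]) =
    motzkin_stat (phi \<alpha>) + motzkin_stat (phi \<beta>) + motzkin_stat (phi \<gamma>)
    + (if \<beta> = [] then 0 else if \<exists>\<xi>. \<gamma> = \<xi> @ [U, D] then 1 else 2)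
    - (if \<exists>\<xi>. \<beta> = \<xi> @ [U, D] then 1 else 0)"
proof -
  let ?w = "phi \<beta> @ [D]"
  \<comment> \<open>\<open>phi \<alpha>\<close> is empty or ends with \<open>D\<close>, which no
    pattern continues past.\<close>
  have "motzkin_stat (phi \<alpha> @ w) = motzkin_stat (phi \<alpha>) + motzkin_stat w" for w
    using assms(1)
  proof (cases rule: phi_last_cases)
    case (3 \<xi> \<eta>)
    then show ?thesis
      by (simp add: motzkin_stat_append[of D \<eta> w] motzkin_stat_Cons)
  qed (use assms(4) in \<open>auto simp: motzkin_stat_Nil\<close>)
  moreover have "motzkin_stat ?w =
      motzkin_stat (phi \<beta>) - (if \<exists>\<xi>. \<beta> = \<xi> @ [U, D] then 1 else 0)"
    using assms(2)
    by (cases rule: phi_last_cases)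
      (auto simp: motzkin_stat_append[of _ _ "[D]"] motzkin_stat_simps)
  moreover have "motzkin_stat (phi \<gamma> @ U # ?w) = motzkin_stat (phi \<gamma>) + motzkin_stat ?w
      + (if \<beta> = [] then 0 else if \<exists>\<xi>. \<gamma> = \<xi> @ [U, D] then 1 else 2)"
  proof -
    have "\<exists>x v. ?w = x # v \<and> (x = D \<longleftrightarrow> \<beta> = [])"
      using phi_hd[OF assms(2)] by (cases "\<beta> = []") auto
    then obtain x v where w: "?w = x # v" "x = D \<longleftrightarrow> \<beta> = []"
      by blast
    \<comment> \<open>\<open>U\<close> and \<open>F\<close> have equal coefficients after
      \<open>U\<close> and after \<open>FU\<close>, so only the emptiness of \<beta>
      matters.\<close>
    then have weight: "motzkin_weight (U # x # v) = (if \<beta> = [] then 0 else 2)"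
      "motzkin_weight (F # U # x # v) = (if \<beta> = [] then 0 else - 1)"
      by (cases x; simp)+
    show ?thesis
      unfolding w(1) using assms(3)
      by (cases rule: phi_last_cases)
        (auto simp: motzkin_stat_append[of _ _ "U # x # v"] motzkin_stat_Cons[of F]
          motzkin_stat_Cons[of D] motzkin_stat_Cons[of U] motzkin_stat_Nil weight)
  qed
  ultimately show ?thesis
    by simp
qed

section \<open>Comparing the corrections\<close>

lemma low_dyck_last:
  assumes "dyck P" "max_height P \<le> 1" "P \<noteq> []"
  shows "\<exists>\<xi>. P = \<xi> @ [U, D]"
proof -
  obtain \<alpha> \<delta> where P: "dyck \<alpha>" "dyck \<delta>" "P = \<alpha> @ U # \<delta> @ [D]"
    using last_return_ex assms(1,3) by metis
  have "\<delta> = []"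
  proof (rule ccontr)
    assume "\<delta> \<noteq> []"
    then obtain w where "\<delta> = U # w"
      using dyck_nonempty_U P(2) by blast
    then have "2 \<le> max_height P"
      using ht_le_max_height[of "\<alpha> @ [U, U]" "w @ [D]"] P by (simp add: dyck_iff)
    then show False
      using assms(2) by simp
  qed
  then show ?thesis
    using P(3) by simp
qed

lemma occ_DDD_eq_motzkin_stat_phi:
  assumes "P \<in> dyck_h_geq"
  shows "int (occ [D, D, D] P) = motzkin_stat (phi P)"
  using assms
proof (induction P rule: phi.induct)
  case 1
  then show ?case
    by (simp add: motzkin_stat_Nil)
next
  case (2 \<alpha>)
  \<comment> \<open>A pattern ending with this \<open>F\<close> would need a \<open>U\<close> before
    it, but \<open>phi \<alpha>\<close> never ends with \<open>U\<close>.\<close>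
  have "motzkin_stat (phi \<alpha> @ [F]) = motzkin_stat (phi \<alpha>)"
    using 2(1)
    by (cases rule: phi_last_cases)
      (auto simp: motzkin_stat_append[of _ _ "[F]"] motzkin_stat_simps)
  moreover have "\<alpha> \<in> dyck_h_geq"
    using dyck_h_geq_last_returnD[of \<alpha> "[]"] 2 by simp
  ultimately show ?case
    using 2 by (simp add: occ_DDD_append_U occ_Cons)
next
  case (3 \<alpha> \<beta> \<gamma>)
  have "dyck (U # \<beta> @ D # \<gamma>)"
    using dyck_append[OF dyck_lift, of \<beta> \<gamma>] 3 by simp
  then have \<alpha>: "\<alpha> \<in> dyck_h_geq" "\<forall>\<xi>. \<alpha> \<noteq> \<xi> @ [U, D]" and "U # \<beta> @ D # \<gamma> \<in> dyck_h_geq"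
    using dyck_h_geq_last_returnD[of \<alpha> "U # \<beta> @ D # \<gamma>"] 3 by auto
  note \<beta>\<gamma> = dyck_h_geq_first_returnD[OF this(3) 3(2)]
  \<comment> \<open>For empty \<beta>, the height condition bounds the height of \<gamma> by that of
    \<open>UD\<close>, which is 1.\<close>
  have low: "\<exists>\<xi>. \<gamma> = \<xi> @ [U, D]" if "\<beta> = []" "\<gamma> \<noteq> []"
    using low_dyck_last[of \<gamma>] \<beta>\<gamma>(3) 3(3) that max_height_UD by simp
  have last_two: "(\<exists>\<xi>. P = \<xi> @ [D, D]) \<longleftrightarrow> P \<noteq> [] \<and> (\<nexists>\<xi>. P = \<xi> @ [U, D])" if "dyck P" for P
    using that by (cases rule: phi_last_cases) auto
  \<comment> \<open>For nonempty \<beta> the corrections agree by \<open>last_two\<close> alone. For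
    empty \<beta> the right one is 0, and \<open>low\<close> excludes the left one's contribution
    from a \<gamma> ending with \<open>DD\<close>.\<close>
  show ?case
    unfolding occ_DDD_UUDD[OF 3(2,3)] phi.simps(3)[OF 3(1-3)]
      motzkin_stat_phi_UUDD[OF 3(1-3) \<alpha>(2)] last_two[OF 3(2)] last_two[OF 3(3)]
      3(4)[OF \<alpha>(1)] 3(5)[OF \<beta>\<gamma>(2)] 3(6)[OF \<beta>\<gamma>(1)]
    using low by (cases "\<beta> = []"; cases "\<gamma> = []") simp_all
next
  case (4 P)
  then show ?case
    using dyck_h_geq_dyck by blast
qed

theorem theorem11:
  fixes n :: nat and P :: "step list"
  assumes "P \<in> dyck_h_geq_n n"
  shows "int (occ [D, D, D] P) =
    2 * (int (occ [U, U] (phi P)) + int (occ [U, F] (phi P)))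
      - int (occ [F, D] (phi P)) - int (occ [F, U, U] (phi P)) - int (occ [F, U, F] (phi P))"
  using assms occ_DDD_eq_motzkin_stat_phi by (simp add: dyck_h_geq_n_def motzkin_stat_def)

end
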